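(* Let $a,b,c>0$, $\Delta t>0$, $\mathbf{A}=\begin{pmatrix}-ac & bc\\ a&-b\end{pmatrix}$, and let $\mathbf{y}^*>\mathbf{0}$ be an arbitrary steady state of $\mathbf{y}'=\mathbf{A}\mathbf{y}$ (i.e. $\mathbf{y}^*\in\ker(\mathbf{A})\cap\mathbb{R}^2_{>0}$). Let $\sigma_1,\sigma_2,r\in\mathcal{C}^2(\mathbb{R}^2_{>0},\mathbb{R}_{>0})$, $\boldsymbol{\sigma}=(\sigma_1,\sigma_2)^{\mathsf T}$, and suppose that $\boldsymbol{\sigma}(\mathbf{v})=\mathbf{v}$ for all $\mathbf{v}\in\ker(\mathbf{A})\cap\mathcal{D}$, where $\mathcal{D}$ is a sufficiently small neighborhood of $\mathbf{y}^*$. Then the gBBKS1 scheme (defined in the context) has the same stability function as the underlying Runge--Kutta method (explicit Euler), i.e. $R(z)=1+z$, and the following holds. a) If $|R(-(ac+b)\Delta t)|<1$, then $\mathbf{y}^*$ is a stable fixed point of the gBBKS1 scheme and there exists a $\delta>0$ such that $(1,c)\mathbf{y}^0=(1,c)\mathbf{y}^*$ and $\|\mathbf{y}^0-\mathbf{y}^*\|<\delta$ imply $\mathbf{y}^n\to\mathbf{y}^*$ as $n\to\infty$. b) If $|R(-(ac+b)\Delta t)|>1$, then $\mathbf{y}^*$ is an unstable fixed point of the gBBKS1 scheme.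
   Context: The first order gBBKS (gBBKS1) scheme applied to $\mathbf{y}'=\mathbf{A}\mathbf{y}$ is implicitly given, for $\mathbf{y}^n\in\mathbb{R}^2_{>0}$, by $$y_i^{n+1}=y_i^n+\Delta t(\mathbf{A}\mathbf{y}^n)_i\Bigl(\prod_{m\in M^n}\frac{y_m^{n+1}}{\sigma_m(\mathbf{y}^n)}\Bigr)^{r(\mathbf{y}^n)},\quad i=1,2,\qquad M^n=\{m\in\{1,2\}\mid(\mathbf{A}\mathbf{y}^n)_m<0\},$$ with the empty product equal to $1$. It is known that for each $\mathbf{y}^n\in\mathbb{R}^2_{>0}$ this has a unique solution $\mathbf{y}^{n+1}\in\mathbb{R}^2_{>0}$; the resulting map is $\mathbf{g}\colon\mathbb{R}^2_{>0}\to\mathbb{R}^2_{>0}$, $\mathbf{y}^{n+1}=\mathbf{g}(\mathbf{y}^n)$. The eigenvalues of $\mathbf{A}$ are $0$ and $\lambda=-(ac+b)$. That $R$ is the stability function means that the eigenvalues of the Jacobian $\mathbf{D}\mathbf{g}(\mathbf{y}^* )$ are $1$ and $R(\Delta t\lambda)$. A fixed point $\mathbf{y}^*$ of $\mathbf{y}^{n+1}=\mathbf{g}(\mathbf{y}^n)$ is stable if for any $\epsilon>0$ there is $\delta>0$ such that $\|\mathbf{y}^0-\mathbf{y}^*\|<\delta$ implies $\|\mathbf{y}^n-\mathbf{y}^*\|<\epsilon$ for all $n\ge0$; it is unstable if it is not stable. *)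

theory Defs
  imports "HOL-Analysis.Analysis"
begin

definition pos_vecs :: "(real^2) set" where
  "pos_vecs = {y. \<forall>i. 0 < y $ i}"

text \<open>Twice continuously differentiable on \<open>S\<close>. The derivatives are taken in the full space,
  so this is only meaningful for open \<open>S\<close>.\<close>

definition C2_on :: "'a::real_normed_vector set \<Rightarrow> ('a \<Rightarrow> 'b::real_normed_vector) \<Rightarrow> bool" where
  "C2_on S f \<longleftrightarrow>
     (\<exists>(f' :: 'a \<Rightarrow> ('a \<Rightarrow>\<^sub>L 'b)) (f'' :: 'a \<Rightarrow> ('a \<Rightarrow>\<^sub>L ('a \<Rightarrow>\<^sub>L 'b))).
        (\<forall>x\<in>S. (f has_derivative blinfun_apply (f' x)) (at x)) \<and>
        (\<forall>x\<in>S. (f' has_derivative blinfun_apply (f'' x)) (at x)) \<and>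
        continuous_on S f'')"

definition gBBKS1_step ::
    "real^2^2 \<Rightarrow> (real^2 \<Rightarrow> real^2) \<Rightarrow> (real^2 \<Rightarrow> real) \<Rightarrow> real \<Rightarrow> real^2 \<Rightarrow> real^2 \<Rightarrow> bool" where
  "gBBKS1_step A \<sigma> r dt y w \<longleftrightarrow>
     (\<forall>i. w $ i = y $ i + dt * (A *v y) $ i *
        (\<Prod>m\<in>{m. (A *v y) $ m < 0}. w $ m / \<sigma> y $ m) powr r y)"

text \<open>The value of the map is only specified for positive \<open>y\<close>.\<close>

definition gBBKS1 ::
    "real^2^2 \<Rightarrow> (real^2 \<Rightarrow> real^2) \<Rightarrow> (real^2 \<Rightarrow> real) \<Rightarrow> real \<Rightarrow> real^2 \<Rightarrow> real^2" where
  "gBBKS1 A \<sigma> r dt y = (THE w. w \<in> pos_vecs \<and> gBBKS1_step A \<sigma> r dt y w)"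

definition stable_fixed_point :: "'a::real_normed_vector set \<Rightarrow> ('a \<Rightarrow> 'a) \<Rightarrow> 'a \<Rightarrow> bool" where
  "stable_fixed_point S g p \<longleftrightarrow> g p = p \<and>
     (\<forall>\<epsilon>>0. \<exists>\<delta>>0. \<forall>y\<in>S. norm (y - p) < \<delta> \<longrightarrow> (\<forall>n. norm ((g ^^ n) y - p) < \<epsilon>))"

definition unstable_fixed_point :: "'a::real_normed_vector set \<Rightarrow> ('a \<Rightarrow> 'a) \<Rightarrow> 'a \<Rightarrow> bool" where
  "unstable_fixed_point S g p \<longleftrightarrow> g p = p \<and> \<not> stable_fixed_point S g p"

text \<open>The complex eigenvalues of a real square matrix.\<close>

definition eigenvalues :: "real^'n^'n \<Rightarrow> complex set" where
  "eigenvalues J =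
     {\<mu>. \<exists>v::complex^'n. v \<noteq> 0 \<and> (\<chi> i j. complex_of_real (J $ i $ j)) *v v = \<mu> *s v}"

definition explicit_euler :: "('a::real_vector \<Rightarrow> 'a) \<Rightarrow> real \<Rightarrow> 'a \<Rightarrow> 'a" where
  "explicit_euler f dt y = y + dt *\<^sub>R f y"

text \<open>\<open>R\<close> is the stability function of the one-step method \<open>\<Phi>\<close> (taking the right-hand side, the
  step size and the current value) if a step applied to \<open>y' = z y\<close> is multiplication by
  \<open>R (dt * z)\<close>.\<close>

definition linear_stability_function ::
    "((complex \<Rightarrow> complex) \<Rightarrow> real \<Rightarrow> complex \<Rightarrow> complex) \<Rightarrow> (complex \<Rightarrow> complex) \<Rightarrow> bool" where
  "linear_stability_function \<Phi> R \<longleftrightarrow>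
     (\<forall>z dt y. \<Phi> (\<lambda>u. z * u) dt y = R (of_real dt * z) * y)"

text \<open>The notion for a nonlinear map \<open>g\<close> (the scheme with step size \<open>dt\<close>) at a fixed point \<open>p\<close>,
  where \<open>l\<close> is the nonzero eigenvalue of the system matrix.\<close>

definition jacobian_stability_function ::
    "(real^2 \<Rightarrow> real^2) \<Rightarrow> real^2 \<Rightarrow> real \<Rightarrow> real \<Rightarrow> (complex \<Rightarrow> complex) \<Rightarrow> bool" where
  "jacobian_stability_function g p dt l R \<longleftrightarrow>
     g differentiable (at p) \<and>
     eigenvalues (matrix (frechet_derivative g (at p))) = {1, R (of_real (dt * l))}"

end

theory Submission
  imports Defs
begin

text \<open>Since \<open>A y\<close> is the multiple \<open>u = a y\<^sub>1 - b y\<^sub>2\<close> of \<open>(-c, 1)\<close>, a step has the form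
  \<open>g y = y + dt \<theta>(y) A y\<close> with a scalar \<open>\<theta>(y)\<close>. It preserves \<open>y\<^sub>1 + c y\<^sub>2\<close> and multiplies
  \<open>u\<close> by \<open>1 - dt (ac + b) \<theta>(y)\<close>. As \<open>\<theta>\<close> is continuous at the steady state with value \<open>1\<close>, the
  Jacobian there is \<open>1 + dt A\<close>, and near the steady state \<open>u\<close> contracts or expands geometrically
  while the other coordinate \<open>y\<^sub>1 + c y\<^sub>2\<close> does not move.\<close>

section \<open>Auxiliary facts from real and vector analysis\<close>

lemma C2_on_imp_isCont:
  assumes "C2_on S f" "x \<in> S"
  shows "isCont f x"
  using assms unfolding C2_on_def by (blast intro: has_derivative_continuous)

lemma linear_stability_function_explicit_euler:
  assumes "linear_stability_function explicit_euler R"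
  shows "R z = 1 + z"
proof -
  have "explicit_euler (\<lambda>u. z * u) 1 1 = R (of_real 1 * z) * 1"
    using assms unfolding linear_stability_function_def by blast
  then show ?thesis by (simp add: explicit_euler_def)
qed

text \<open>The left-hand side is continuous and strictly increasing for \<open>x\<close> at least
  0, vanishes at 0 and is at least \<open>y\<close> at \<open>x = y\<close>. This is the scalar
  equation of the component that decreases in a step.\<close>

lemma ex1_pos_root_add_powr:
  fixes k s p y :: real
  assumes "0 \<le> k" "0 < s" "0 < p" "0 < y"
  shows "\<exists>!x. 0 < x \<and> x + k * (x / s) powr p = y"
proof -
  define f where "f x = x + k * (x / s) powr p" for x
  have mono: "f x < f x'" if "0 \<le> x" "x < x'" for x x'
  proof -
    have "(x / s) powr p \<le> (x' / s) powr p"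
      using that assms by (intro powr_mono2) (auto simp: divide_right_mono)
    with that assms show ?thesis
      unfolding f_def by (intro add_less_le_mono mult_left_mono) auto
  qed
  have "\<exists>x. 0 \<le> x \<and> x \<le> y \<and> f x = y"
  proof (rule IVT')
    show "f 0 \<le> y" "y \<le> f y" using assms by (auto simp: f_def)
    show "continuous_on {0..y} f"
      unfolding f_def using assms by (intro continuous_intros continuous_on_powr') auto
  qed (use assms in auto)
  then obtain x where x: "0 \<le> x" "f x = y" by blast
  have "f 0 = 0" by (simp add: f_def)
  with x assms have "0 < x" by (cases "x = 0") auto
  with x show ?thesis
    unfolding f_def[symmetric] by (metis less_imp_le linorder_neqE_linordered_idom mono order_less_irrefl)
qed

text \<open>Since \<open>f p = 0\<close>, the remainder is exactly
  \<open>(\<phi> y - \<phi> p) *\<^sub>R f (y - p)\<close>, which is small compared with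
  \<open>y - p\<close> by continuity of the factor. It serves to differentiate the scheme on the
  line where the formula for \<open>\<theta>\<close> switches.\<close>

lemma has_derivative_scaleR_vanishing:
  fixes f :: "'a::real_normed_vector \<Rightarrow> 'b::real_normed_vector"
  assumes f: "bounded_linear f" and "f p = 0" "isCont \<phi> p"
  shows "((\<lambda>y. \<phi> y *\<^sub>R f y) has_derivative (\<lambda>h. \<phi> p *\<^sub>R f h)) (at p)"
proof -
  interpret bounded_linear f by fact
  obtain K where K: "\<And>x. norm (f x) \<le> norm x * K" using bounded by blast
  have lim: "((\<lambda>y. \<bar>\<phi> y - \<phi> p\<bar> * K) \<longlongrightarrow> 0) (at p)"
    using assms(3) by (auto simp: isCont_def intro!: tendsto_eq_intros tendsto_rabs)
  have "((\<lambda>y. norm (\<phi> y *\<^sub>R f y - \<phi> p *\<^sub>R f p - \<phi> p *\<^sub>R f (y - p)) / norm (y - p)) \<longlongrightarrow> 0) (at p)"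
  proof (rule tendsto_sandwich[OF _ _ tendsto_const lim])
    show "\<forall>\<^sub>F y in at p. norm (\<phi> y *\<^sub>R f y - \<phi> p *\<^sub>R f p - \<phi> p *\<^sub>R f (y - p)) / norm (y - p)
        \<le> \<bar>\<phi> y - \<phi> p\<bar> * K"
      unfolding eventually_at_filter
    proof (intro always_eventually allI impI)
      fix y assume "y \<noteq> p"
      have "\<phi> y *\<^sub>R f y - \<phi> p *\<^sub>R f p - \<phi> p *\<^sub>R f (y - p) = (\<phi> y - \<phi> p) *\<^sub>R f (y - p)"
        by (simp add: diff \<open>f p = 0\<close> algebra_simps)
      moreover have "norm (\<dots>) \<le> \<bar>\<phi> y - \<phi> p\<bar> * (norm (y - p) * K)"
        using K[of "y - p"] by (simp add: mult_left_mono)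
      ultimately show "norm (\<phi> y *\<^sub>R f y - \<phi> p *\<^sub>R f p - \<phi> p *\<^sub>R f (y - p)) / norm (y - p)
        \<le> \<bar>\<phi> y - \<phi> p\<bar> * K"
        using \<open>y \<noteq> p\<close> by (simp add: divide_le_eq mult_ac)
    qed
  qed auto
  then show ?thesis
    unfolding has_derivative_iff_norm using bounded_linear_scaleR_right[THEN bounded_linear_compose, OF f]
    by auto
qed

lemma open_pos_vecs: "open pos_vecs"
proof -
  have eq: "pos_vecs = (\<Inter>i. {y. 0 < y $ i})" by (auto simp: pos_vecs_def)
  show ?thesis unfolding eq by (intro open_INT ballI open_Collect_less continuous_intros) simp
qed

section \<open>One step in the plane: solvability, invariant and a priori bound\<close>

locale gbbks_2d =
  fixes a b c dt :: real and A :: "real^2^2"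
    and \<sigma> :: "real^2 \<Rightarrow> real^2" and r :: "real^2 \<Rightarrow> real"
  assumes pos: "0 < a" "0 < b" "0 < c" "0 < dt"
    and A_eq: "A = vector [vector [- a * c, b * c], vector [a, - b]]"
    and \<sigma>_pos: "\<And>m v. v \<in> pos_vecs \<Longrightarrow> 0 < \<sigma> v $ m"
    and r_pos: "\<And>v. v \<in> pos_vecs \<Longrightarrow> 0 < r v"
begin

text \<open>The row \<open>(a, -b)\<close> is a left eigenvector of \<open>A\<close> for the
  eigenvalue \<open>-(a * c + b)\<close>; this is why a step only rescales \<open>u\<close>.\<close>

definition u :: "real^2 \<Rightarrow> real" where
  "u y = a * y $ 1 - b * y $ 2"

text \<open>The row \<open>(1, c)\<close> is a left eigenvector of \<open>A\<close> for the
  eigenvalue 0, that is, a linear invariant of the system.\<close>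

definition s :: "real^2 \<Rightarrow> real" where
  "s y = y $ 1 + c * y $ 2"

lemma A_mult [simp]: "(A *v y) $ 1 = - c * u y" "(A *v y) $ 2 = u y"
  by (simp_all add: A_eq u_def matrix_vector_mult_def sum_2 algebra_simps)

lemma A_mult_eq_0_iff: "A *v y = 0 \<longleftrightarrow> u y = 0"
  by (auto simp: vec_eq_iff forall_2)

text \<open>The two components of \<open>A *v y\<close> have opposite signs, so the product in the
  scheme has at most one factor.\<close>

lemma neg_components:
  "{m. (A *v y) $ m < 0} = (if 0 < u y then {1} else if u y < 0 then {2} else {})"
proof -
  have "(A *v y) $ m < 0 \<longleftrightarrow> (m = 1 \<and> 0 < u y \<or> m = 2 \<and> u y < 0)" for m
    using exhaust_2[of m] pos by (auto simp: mult_less_0_iff zero_less_mult_iff)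
  then show ?thesis by auto
qed

abbreviation g :: "real^2 \<Rightarrow> real^2" where
  "g \<equiv> gBBKS1 A \<sigma> r dt"

text \<open>Inserting the solution \<open>g y\<close> into the product makes the implicit step read
  like an Euler step with a modified step size.\<close>

definition \<theta> :: "real^2 \<Rightarrow> real" where
  "\<theta> y = (\<Prod>m\<in>{m. (A *v y) $ m < 0}. g y $ m / \<sigma> y $ m) powr r y"

lemma \<theta>_cases:
  "\<theta> y = (if 0 < u y then (g y $ 1 / \<sigma> y $ 1) powr r y
    else if u y < 0 then (g y $ 2 / \<sigma> y $ 2) powr r y else 1)"
  by (simp add: \<theta>_def neg_components)

lemma \<theta>_nonneg: "0 \<le> \<theta> y"
  by (simp add: \<theta>_def)

text \<open>The equations decouple: the decreasing component solves a scalar root problem of its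
  own, and the other one is then given explicitly and can only grow, hence stays positive. For
  \<open>u y = 0\<close> the step is the identity.\<close>

lemma ex1_step:
  assumes y: "y \<in> pos_vecs"
  shows "\<exists>!w. w \<in> pos_vecs \<and> gBBKS1_step A \<sigma> r dt y w"
proof -
  have y12: "0 < y $ 1" "0 < y $ 2" using y by (auto simp: pos_vecs_def)
  have pos_iff: "w \<in> pos_vecs \<longleftrightarrow> 0 < w $ 1 \<and> 0 < w $ 2" for w
    by (auto simp: pos_vecs_def forall_2)
  consider "0 < u y" | "u y < 0" | "u y = 0" by linarith
  then show ?thesis
  proof cases
    case 1
    have step: "gBBKS1_step A \<sigma> r dt y w \<longleftrightarrow>
        w $ 1 + dt * c * u y * (w $ 1 / \<sigma> y $ 1) powr r y = y $ 1 \<and>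
        w $ 2 = y $ 2 + dt * u y * (w $ 1 / \<sigma> y $ 1) powr r y" for w
      using 1 by (simp add: gBBKS1_step_def forall_2 neg_components algebra_simps)
    have ex1: "\<exists>!x. 0 < x \<and> x + dt * c * u y * (x / \<sigma> y $ 1) powr r y = y $ 1"
      using 1 pos y12 \<sigma>_pos[OF y] r_pos[OF y] by (intro ex1_pos_root_add_powr) auto
    then obtain x where x: "0 < x" "x + dt * c * u y * (x / \<sigma> y $ 1) powr r y = y $ 1" by blast
    show ?thesis
    proof (rule ex1I[where a="vector [x, y $ 2 + dt * u y * (x / \<sigma> y $ 1) powr r y]"])
      show "vector [x, y $ 2 + dt * u y * (x / \<sigma> y $ 1) powr r y] \<in> pos_vecs \<and>
        gBBKS1_step A \<sigma> r dt y (vector [x, y $ 2 + dt * u y * (x / \<sigma> y $ 1) powr r y])"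
        using x 1 pos y12 by (auto simp: step pos_iff intro!: add_pos_nonneg)
    next
      fix w assume "w \<in> pos_vecs \<and> gBBKS1_step A \<sigma> r dt y w"
      moreover from this have "w $ 1 = x" using ex1 x unfolding step pos_iff by blast
      ultimately show "w = vector [x, y $ 2 + dt * u y * (x / \<sigma> y $ 1) powr r y]"
        by (simp add: step vec_eq_iff forall_2)
    qed
  next
    case 2
    have step: "gBBKS1_step A \<sigma> r dt y w \<longleftrightarrow>
        w $ 2 + dt * (- u y) * (w $ 2 / \<sigma> y $ 2) powr r y = y $ 2 \<and>
        w $ 1 = y $ 1 + dt * c * (- u y) * (w $ 2 / \<sigma> y $ 2) powr r y" for w
      using 2 by (simp add: gBBKS1_step_def forall_2 neg_components algebra_simps conj_commute)
    have ex1: "\<exists>!x. 0 < x \<and> x + dt * (- u y) * (x / \<sigma> y $ 2) powr r y = y $ 2"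
      using 2 pos y12 \<sigma>_pos[OF y] r_pos[OF y]
      by (intro ex1_pos_root_add_powr) (auto simp: mult_le_0_iff)
    then obtain x where x: "0 < x" "x + dt * (- u y) * (x / \<sigma> y $ 2) powr r y = y $ 2" by blast
    show ?thesis
    proof (rule ex1I[where a="vector [y $ 1 + dt * c * (- u y) * (x / \<sigma> y $ 2) powr r y, x]"])
      have "0 \<le> dt * c * (- u y) * (x / \<sigma> y $ 2) powr r y"
        using 2 pos by (intro mult_nonneg_nonneg) auto
      then show "vector [y $ 1 + dt * c * (- u y) * (x / \<sigma> y $ 2) powr r y, x] \<in> pos_vecs \<and>
        gBBKS1_step A \<sigma> r dt y (vector [y $ 1 + dt * c * (- u y) * (x / \<sigma> y $ 2) powr r y, x])"
        unfolding step pos_iff using x y12 by auto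
    next
      fix w assume "w \<in> pos_vecs \<and> gBBKS1_step A \<sigma> r dt y w"
      moreover from this have "w $ 2 = x" using ex1 x unfolding step pos_iff by blast
      ultimately show "w = vector [y $ 1 + dt * c * (- u y) * (x / \<sigma> y $ 2) powr r y, x]"
        by (simp add: step vec_eq_iff forall_2)
    qed
  next
    case 3
    then have "gBBKS1_step A \<sigma> r dt y w \<longleftrightarrow> w = y" for w
      by (auto simp: gBBKS1_step_def forall_2 vec_eq_iff)
    with y show ?thesis by auto
  qed
qed

lemma
  assumes "y \<in> pos_vecs"
  shows g_pos: "g y \<in> pos_vecs"
    and g_eq: "g y = y + (dt * \<theta> y) *\<^sub>R (A *v y)"
proof -
  have *: "g y \<in> pos_vecs \<and> gBBKS1_step A \<sigma> r dt y (g y)"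
    unfolding gBBKS1_def using ex1_step[OF assms] by (rule theI')
  then show "g y \<in> pos_vecs" ..
  show "g y = y + (dt * \<theta> y) *\<^sub>R (A *v y)"
    unfolding vec_eq_iff
  proof
    fix i
    have "g y $ i = y $ i + dt * (A *v y) $ i * \<theta> y"
      unfolding \<theta>_def using * gBBKS1_step_def by blast
    then show "g y $ i = (y + (dt * \<theta> y) *\<^sub>R (A *v y)) $ i"
      by simp
  qed
qed

lemma funpow_g_pos: "y \<in> pos_vecs \<Longrightarrow> (g ^^ n) y \<in> pos_vecs"
  by (induction n) (auto simp: g_pos)

lemma s_g: "y \<in> pos_vecs \<Longrightarrow> s (g y) = s y"
  by (simp add: g_eq s_def algebra_simps)

lemma s_funpow_g: "y \<in> pos_vecs \<Longrightarrow> s ((g ^^ n) y) = s y"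
  by (induction n) (auto simp: s_g funpow_g_pos)

lemma u_g: "y \<in> pos_vecs \<Longrightarrow> u (g y) = (1 - dt * (a * c + b) * \<theta> y) * u y"
  \<comment> \<open>The outer \<open>u\<close> is unfolded first, so that the components of
    \<open>A *v y\<close> become multiples of \<open>u y\<close> before \<open>u y\<close> itself is
    expanded.\<close>
  by (simp add: g_eq u_def[of "y + _"]) (simp add: u_def algebra_simps)

text \<open>The component occurring in the product decreases in the step, so replacing its new value
  by the old one enlarges the factor and removes \<open>g\<close> from the bound. Adding up the
  three cases avoids a case distinction on the sign of \<open>u y\<close>.\<close>

lemma \<theta>_le:
  assumes y: "y \<in> pos_vecs"
  shows "\<theta> y \<le> 1 + (y $ 1 / \<sigma> y $ 1) powr r y + (y $ 2 / \<sigma> y $ 2) powr r y"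
proof -
  note \<sigma> = \<sigma>_pos[OF y]
  have gpos: "0 < g y $ m" for m using g_pos[OF y] by (simp add: pos_vecs_def)
  have le: "(g y $ m / \<sigma> y $ m) powr r y \<le> (y $ m / \<sigma> y $ m) powr r y" if "(A *v y) $ m \<le> 0" for m
  proof -
    have "dt * \<theta> y * (A *v y) $ m \<le> 0"
      using that pos \<theta>_nonneg[of y] by (simp add: mult_nonneg_nonpos)
    then have "g y $ m \<le> y $ m" by (simp add: g_eq[OF y])
    then show ?thesis
      using \<sigma>[of m] gpos[of m] r_pos[OF y] by (intro powr_mono2) (auto simp: divide_right_mono less_imp_le)
  qed
  have nn: "0 \<le> (y $ m / \<sigma> y $ m) powr r y" for m by simp
  have "0 < u y \<Longrightarrow> \<theta> y \<le> (y $ 1 / \<sigma> y $ 1) powr r y"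
    and "u y < 0 \<Longrightarrow> \<theta> y \<le> (y $ 2 / \<sigma> y $ 2) powr r y"
    and "u y = 0 \<Longrightarrow> \<theta> y \<le> 1"
    using le[of 1] le[of 2] pos by (auto simp: \<theta>_cases)
  with nn[of 1] nn[of 2] show ?thesis by linarith
qed

section \<open>The norm compared with the coordinates \<open>s\<close> and \<open>u\<close>\<close>

text \<open>The map to \<open>(s, u)\<close> has determinant \<open>-(a * c + b)\<close>, which is
  nonzero, and Cramer's rule inverts it. The numerator of the constant crudely dominates both
  \<open>a + b\<close> and \<open>1 + c\<close>.\<close>

lemma norm_le_coords:
  "norm y \<le> (1 + a + b + c) / (a * c + b) * (\<bar>s y\<bar> + \<bar>u y\<bar>)"
proof -
  define k where "k = a * c + b"
  have k: "0 < k" using pos by (simp add: k_def add_pos_pos)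
  have y: "y $ 1 = (b * s y + c * u y) / k" "y $ 2 = (a * s y - u y) / k"
    using k by (simp_all add: field_simps) (simp_all add: k_def s_def u_def algebra_simps)
  have "\<bar>y $ 1\<bar> \<le> (b * \<bar>s y\<bar> + c * \<bar>u y\<bar>) / k"
    unfolding y(1) using k pos abs_triangle_ineq[of "b * s y" "c * u y"]
    by (simp add: abs_mult divide_right_mono)
  moreover have "\<bar>y $ 2\<bar> \<le> (a * \<bar>s y\<bar> + \<bar>u y\<bar>) / k"
    unfolding y(2) using k pos abs_triangle_ineq4[of "a * s y" "u y"]
    by (simp add: abs_mult divide_right_mono)
  moreover have "norm y \<le> \<bar>y $ 1\<bar> + \<bar>y $ 2\<bar>"
    using norm_le_l1_cart[of y] by (simp add: sum_2)
  ultimately have "norm y \<le> (b * \<bar>s y\<bar> + c * \<bar>u y\<bar>) / k + (a * \<bar>s y\<bar> + \<bar>u y\<bar>) / k"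
    by linarith
  also have "\<dots> = ((a + b) * \<bar>s y\<bar> + (1 + c) * \<bar>u y\<bar>) / k"
    by (simp add: add_divide_distrib algebra_simps)
  also have "\<dots> \<le> ((1 + a + b + c) * \<bar>s y\<bar> + (1 + a + b + c) * \<bar>u y\<bar>) / k"
    using k pos by (intro divide_right_mono add_mono[OF mult_right_mono mult_right_mono]) auto
  finally show ?thesis by (simp add: k_def algebra_simps)
qed

lemma
  shows abs_s_le: "\<bar>s y\<bar> \<le> (1 + c) * norm y"
    and abs_u_le: "\<bar>u y\<bar> \<le> (a + b) * norm y"
proof -
  have 1: "\<bar>y $ 1\<bar> \<le> norm y" and 2: "\<bar>y $ 2\<bar> \<le> norm y" by (rule component_le_norm_cart)+
  have "\<bar>s y\<bar> \<le> \<bar>y $ 1\<bar> + c * \<bar>y $ 2\<bar>"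
    unfolding s_def using pos abs_triangle_ineq[of "y $ 1" "c * y $ 2"] by (simp add: abs_mult)
  with 1 mult_left_mono[OF 2, of c] pos show "\<bar>s y\<bar> \<le> (1 + c) * norm y"
    by (simp only: distrib_right) linarith
  have "\<bar>u y\<bar> \<le> a * \<bar>y $ 1\<bar> + b * \<bar>y $ 2\<bar>"
    unfolding u_def using pos abs_triangle_ineq4[of "a * y $ 1" "b * y $ 2"] by (simp add: abs_mult)
  with pos mult_left_mono[OF 1, of a] mult_left_mono[OF 2, of b] show "\<bar>u y\<bar> \<le> (a + b) * norm y"
    by (simp only: distrib_right) linarith
qed

lemma
  shows s_diff: "s (x - y) = s x - s y" and u_diff: "u (x - y) = u x - u y"
  by (simp_all add: s_def u_def algebra_simps)

end

section \<open>Continuity of the step and its Jacobian at a steady state\<close>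

locale gbbks_2d_steady = gbbks_2d +
  fixes p :: "real^2"
  assumes p_pos: "p \<in> pos_vecs" and u_p: "u p = 0" and \<sigma>_p: "\<sigma> p = p"
    and \<sigma>_cont: "\<And>m. isCont (\<lambda>v. \<sigma> v $ m) p" and r_cont: "isCont r p"
begin

lemma \<theta>_p: "\<theta> p = 1"
  by (simp add: \<theta>_cases u_p)

lemma A_p: "A *v p = 0"
  by (simp add: A_mult_eq_0_iff u_p)

lemma g_p: "g p = p"
  by (simp add: g_eq p_pos A_p)

lemma eventually_pos: "eventually (\<lambda>y. y \<in> pos_vecs) (at p)"
  using eventually_at_in_open'[OF open_pos_vecs p_pos] .

lemma p_comp_pos: "0 < p $ m"
  using p_pos by (simp add: pos_vecs_def)

lemma tendsto_comp: "((\<lambda>y. y $ m) \<longlongrightarrow> p $ m) (at p)"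
  by (intro tendsto_intros)

lemma tendsto_\<sigma>: "((\<lambda>y. \<sigma> y $ m) \<longlongrightarrow> p $ m) (at p)"
  using \<sigma>_cont[of m] by (simp add: isCont_def \<sigma>_p)

text \<open>The quotient tends to 1 because \<open>\<sigma> p = p\<close>, and 1 to any power is 1.
  Taking a general \<open>f\<close> covers both the old value \<open>y\<close> and the new value
  \<open>g y\<close>.\<close>

lemma tendsto_ratio_powr:
  assumes "((\<lambda>y. f y $ m) \<longlongrightarrow> p $ m) (at p)"
  shows "((\<lambda>y. (f y $ m / \<sigma> y $ m) powr r y) \<longlongrightarrow> 1) (at p)"
proof -
  have r: "(r \<longlongrightarrow> r p) (at p)" using r_cont by (simp add: isCont_def)
  have "((\<lambda>y. (f y $ m / \<sigma> y $ m) powr r y) \<longlongrightarrow> (p $ m / p $ m) powr r p) (at p)"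
    using p_comp_pos[of m] by (intro tendsto_powr tendsto_divide assms tendsto_\<sigma> r) auto
  then show ?thesis using p_comp_pos[of m] by simp
qed

text \<open>\<open>\<theta>\<close> is defined through \<open>g\<close>; an a priori bound on \<open>\<theta>\<close> breaks the circularity.\<close>

lemma tendsto_g: "(g \<longlongrightarrow> p) (at p)"
proof -
  have "((\<lambda>y. 1 + (y $ 1 / \<sigma> y $ 1) powr r y + (y $ 2 / \<sigma> y $ 2) powr r y) \<longlongrightarrow> 1 + 1 + 1) (at p)"
    by (intro tendsto_add tendsto_const tendsto_ratio_powr tendsto_comp)
  then have "eventually (\<lambda>y. 1 + (y $ 1 / \<sigma> y $ 1) powr r y + (y $ 2 / \<sigma> y $ 2) powr r y < 4) (at p)"
    by (rule order_tendstoD) simp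
  with eventually_pos have ev: "eventually (\<lambda>y. norm (g y - y) \<le> dt * 4 * norm (A *v y)) (at p)"
  proof eventually_elim
    case (elim y)
    with \<theta>_le[of y] have "\<theta> y \<le> 4" by simp
    with elim pos \<theta>_nonneg[of y] show ?case
      by (simp add: g_eq abs_mult mult_right_mono)
  qed
  have "((\<lambda>y. A *v y) \<longlongrightarrow> A *v p) (at p)"
    using linear_continuous_at[OF matrix_vector_mul_bounded_linear[of A], of p] by (simp add: isCont_def)
  then have "((\<lambda>y. dt * 4 * norm (A *v y)) \<longlongrightarrow> 0) (at p)"
    by (auto simp: A_p intro!: tendsto_mult_right_zero tendsto_norm_zero)
  from Lim_null_comparison[OF ev this] have "((\<lambda>y. (g y - y) + y) \<longlongrightarrow> 0 + p) (at p)"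
    by (intro tendsto_add tendsto_ident_at)
  then show ?thesis by simp
qed

text \<open>The sign of \<open>u\<close> varies around \<open>p\<close>, so no single branch of
  \<open>\<theta>_cases\<close> applies; instead every branch is shown to be close to 1.\<close>

lemma isCont_\<theta>: "isCont \<theta> p"
  unfolding isCont_def \<theta>_p
proof (rule tendstoI)
  fix e :: real assume e: "0 < e"
  have "eventually (\<lambda>y. dist ((g y $ m / \<sigma> y $ m) powr r y) 1 < e) (at p)" for m
    by (rule tendstoD[OF tendsto_ratio_powr[OF tendsto_vec_nth[OF tendsto_g]] e])
  from this[of 1] this[of 2] show "eventually (\<lambda>y. dist (\<theta> y) 1 < e) (at p)"
    by eventually_elim (use e in \<open>auto simp: \<theta>_cases\<close>)
qed

text \<open>As \<open>A *v p = 0\<close>, the factor \<open>\<theta>\<close> enters through its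
  value 1 at \<open>p\<close>. The linearisation is therefore that of explicit Euler, whence the
  common stability function.\<close>

lemma has_derivative_g: "(g has_derivative (\<lambda>h. h + dt *\<^sub>R (A *v h))) (at p)"
proof (rule has_derivative_transform_within_open[OF _ open_pos_vecs p_pos])
  have "((\<lambda>y. \<theta> y *\<^sub>R (A *v y)) has_derivative (\<lambda>h. \<theta> p *\<^sub>R (A *v h))) (at p)"
    by (rule has_derivative_scaleR_vanishing) (auto simp: A_p isCont_\<theta>)
  then have "((\<lambda>y. y + dt *\<^sub>R (\<theta> y *\<^sub>R (A *v y))) has_derivative
      (\<lambda>h. h + dt *\<^sub>R (\<theta> p *\<^sub>R (A *v h)))) (at p)"
    by (intro has_derivative_add has_derivative_ident has_derivative_scaleR_right)
  then show "((\<lambda>y. y + (dt * \<theta> y) *\<^sub>R (A *v y)) has_derivative (\<lambda>h. h + dt *\<^sub>R (A *v h))) (at p)"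
    by (simp add: \<theta>_p)
qed (simp add: g_eq)

text \<open>With \<open>U\<close> the complex version of \<open>u\<close>, the Jacobian sends
  \<open>v\<close> to \<open>v + dt * U v * (-c, 1)\<close>, and hence multiplies \<open>U\<close>
  by \<open>1 - k\<close>. So an eigenvector has eigenvalue \<open>1 - k\<close>, or
  \<open>U v = 0\<close> and it is fixed.\<close>

lemma eigenvalues_jacobian:
  "eigenvalues (matrix (frechet_derivative g (at p))) = {1, 1 - of_real (dt * (a * c + b))}"
proof -
  let ?J = "matrix (frechet_derivative g (at p))"
  define k where "k = complex_of_real (dt * (a * c + b))"
  define U where "U v = of_real a * v $ 1 - of_real b * v $ 2" for v :: "complex^2"
  have fd: "frechet_derivative g (at p) = (\<lambda>h. h + dt *\<^sub>R (A *v h))"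
    using frechet_derivative_at[OF has_derivative_g] by simp
  have J: "?J $ 1 $ 1 = 1 - dt * c * a" "?J $ 1 $ 2 = dt * c * b"
      "?J $ 2 $ 1 = dt * a" "?J $ 2 $ 2 = 1 - dt * b"
    by (simp_all add: fd matrix_def u_def axis_def)
  have eig: "(\<chi> i j. complex_of_real (?J $ i $ j)) *v v = \<mu> *s v \<longleftrightarrow>
      v $ 1 - of_real (dt * c) * U v = \<mu> * v $ 1 \<and> v $ 2 + of_real dt * U v = \<mu> * v $ 2" for v \<mu>
    by (simp add: J vec_eq_iff forall_2 matrix_vector_mult_def sum_2 U_def algebra_simps)
  show ?thesis
  proof (intro equalityI subsetI)
    fix \<mu> assume "\<mu> \<in> eigenvalues ?J"
    then obtain v where v: "v \<noteq> 0"
      "v $ 1 - of_real (dt * c) * U v = \<mu> * v $ 1" "v $ 2 + of_real dt * U v = \<mu> * v $ 2"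
      unfolding eigenvalues_def mem_Collect_eq eig by blast
    show "\<mu> \<in> {1, 1 - of_real (dt * (a * c + b))}"
    proof (rule ccontr)
      assume "\<mu> \<notin> {1, 1 - of_real (dt * (a * c + b))}"
      then have \<mu>: "\<mu> \<noteq> 1" "\<mu> \<noteq> 1 - k" by (auto simp: k_def)
      have "\<mu> * U v = of_real a * (\<mu> * v $ 1) - of_real b * (\<mu> * v $ 2)"
        by (simp add: U_def algebra_simps)
      also have "\<dots> = (1 - k) * U v"
        unfolding v(2,3)[symmetric] by (simp add: U_def k_def algebra_simps)
      finally have "U v = 0" using \<mu> by simp
      with v \<mu> have "v $ 1 = 0" "v $ 2 = 0" by auto
      with v(1) show False by (simp add: vec_eq_iff forall_2)
    qed
  next
    fix \<mu> :: complex assume "\<mu> \<in> {1, 1 - of_real (dt * (a * c + b))}"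
    then consider "\<mu> = 1" | "\<mu> = 1 - k" by (auto simp: k_def)
    then show "\<mu> \<in> eigenvalues ?J"
    proof cases
      case 1
      then show ?thesis
        unfolding eigenvalues_def mem_Collect_eq eig using pos
        \<comment> \<open>The vector \<open>(b, a)\<close> spans the kernel of
          \<open>A\<close>.\<close>
        by (intro exI[of _ "vector [of_real b, of_real a]"]) (auto simp: U_def vec_eq_iff forall_2)
    next
      case 2
      then show ?thesis
        unfolding eigenvalues_def mem_Collect_eq eig 2
        \<comment> \<open>The vector \<open>(-c, 1)\<close> spans the range of \<open>A\<close>, and
          \<open>U\<close> takes the value \<open>-(a * c + b)\<close> there.\<close>
        by (intro exI[of _ "vector [- of_real c, 1]"])
          (simp add: U_def vec_eq_iff forall_2 k_def algebra_simps)
    qed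
  qed
qed

section \<open>Local contraction and expansion of \<open>u\<close>\<close>

text \<open>Taking \<open>nhds p\<close> rather than \<open>at p\<close> gives estimates on a full
  ball, centre included.\<close>

lemma tendsto_factor:
  "((\<lambda>y. \<bar>1 - dt * (a * c + b) * \<theta> y\<bar>) \<longlongrightarrow> \<bar>1 - dt * (a * c + b)\<bar>) (nhds p)"
proof -
  have "(\<theta> \<longlongrightarrow> 1) (nhds p)"
    using isCont_\<theta> tendsto_at_iff_tendsto_nhds[of \<theta> p] by (simp add: isCont_def \<theta>_p)
  then show ?thesis by (auto intro!: tendsto_eq_intros)
qed

text \<open>The gap between the limiting factor and 1 leaves room for a rate \<open>q\<close> that
  absorbs the variation of \<open>\<theta>\<close> near \<open>p\<close>.\<close>

lemma contraction:
  assumes "\<bar>1 - dt * (a * c + b)\<bar> < 1"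
  obtains q \<eta> where "0 \<le> q" "q < 1" "0 < \<eta>"
    "\<And>y. \<lbrakk>y \<in> pos_vecs; norm (y - p) < \<eta>\<rbrakk> \<Longrightarrow> \<bar>u (g y)\<bar> \<le> q * \<bar>u y\<bar>"
proof -
  obtain q where q: "\<bar>1 - dt * (a * c + b)\<bar> < q" "q < 1" using dense[OF assms] by blast
  have "eventually (\<lambda>y. \<bar>1 - dt * (a * c + b) * \<theta> y\<bar> < q) (nhds p)"
    using tendsto_factor q(1) by (rule order_tendstoD)
  then obtain \<eta> where \<eta>: "0 < \<eta>" "\<And>y. dist y p < \<eta> \<Longrightarrow> \<bar>1 - dt * (a * c + b) * \<theta> y\<bar> < q"
    by (auto simp: eventually_nhds_metric)
  show ?thesis
  proof (rule that[OF _ q(2) \<eta>(1)])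
    show "\<bar>u (g y)\<bar> \<le> q * \<bar>u y\<bar>" if "y \<in> pos_vecs" "norm (y - p) < \<eta>" for y
      unfolding u_g[OF that(1)] abs_mult using \<eta>(2)[of y] that(2)
      by (intro mult_right_mono[OF less_imp_le abs_ge_zero]) (auto simp: dist_norm)
  qed (use q in simp)
qed

lemma expansion:
  assumes "1 < \<bar>1 - dt * (a * c + b)\<bar>"
  obtains q \<eta> where "1 < q" "0 < \<eta>"
    "\<And>y. \<lbrakk>y \<in> pos_vecs; norm (y - p) < \<eta>\<rbrakk> \<Longrightarrow> q * \<bar>u y\<bar> \<le> \<bar>u (g y)\<bar>"
proof -
  obtain q where q: "1 < q" "q < \<bar>1 - dt * (a * c + b)\<bar>" using dense[OF assms] by blast
  have "eventually (\<lambda>y. q < \<bar>1 - dt * (a * c + b) * \<theta> y\<bar>) (nhds p)"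
    using tendsto_factor q(2) by (rule order_tendstoD)
  then obtain \<eta> where \<eta>: "0 < \<eta>" "\<And>y. dist y p < \<eta> \<Longrightarrow> q < \<bar>1 - dt * (a * c + b) * \<theta> y\<bar>"
    by (auto simp: eventually_nhds_metric)
  show ?thesis
  proof (rule that[OF q(1) \<eta>(1)])
    show "q * \<bar>u y\<bar> \<le> \<bar>u (g y)\<bar>" if "y \<in> pos_vecs" "norm (y - p) < \<eta>" for y
      unfolding u_g[OF that(1)] abs_mult using \<eta>(2)[of y] that(2)
      by (intro mult_right_mono[OF less_imp_le abs_ge_zero]) (auto simp: dist_norm)
  qed
qed

lemma norm_diff_p_le:
  "norm (y - p) \<le> (1 + a + b + c) / (a * c + b) * (\<bar>s y - s p\<bar> + \<bar>u y\<bar>)"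
  using norm_le_coords[of "y - p"] by (simp add: s_diff u_diff u_p)

lemma abs_u_le_dist: "\<bar>u y\<bar> \<le> (a + b) * norm (y - p)"
  using abs_u_le[of "y - p"] by (simp add: u_diff u_p)

section \<open>Stability, attraction and instability\<close>

text \<open>A bootstrap: \<open>u\<close> is known to contract while the orbit stays in the
  \<open>\<eta>\<close>-ball, and the orbit stays there because \<open>u\<close> has not grown and
  \<open>s\<close> is constant. One induction delivers both.\<close>

lemma
  assumes R: "\<bar>1 - dt * (a * c + b)\<bar> < 1"
  shows stable: "stable_fixed_point pos_vecs g p"
    and attracting: "\<exists>\<delta>>0. \<forall>y\<in>pos_vecs. s y = s p \<longrightarrow> norm (y - p) < \<delta> \<longrightarrow>
          (\<lambda>n. (g ^^ n) y) \<longlonglongrightarrow> p"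
proof -
  obtain q \<eta> where q: "0 \<le> q" "q < 1" and \<eta>: "0 < \<eta>"
    and contr: "\<And>y. \<lbrakk>y \<in> pos_vecs; norm (y - p) < \<eta>\<rbrakk> \<Longrightarrow> \<bar>u (g y)\<bar> \<le> q * \<bar>u y\<bar>"
    using contraction[OF R] by metis
  define C where "C = (1 + a + b + c) / (a * c + b)"
  \<comment> \<open>\<open>C\<close> turns bounds on \<open>s\<close> and \<open>u\<close> into a
    norm bound; the other factor is \<open>(1 + c) + (a + b)\<close>, the cost of the way back.
    Starting within \<open>e / K\<close> thus keeps the orbit within \<open>e\<close>.\<close>
  define K where "K = C * (1 + a + b + c)"
  have C: "0 < C" and K: "0 < K" using pos by (auto simp: K_def C_def intro!: divide_pos_pos add_pos_pos)
  have key: "norm ((g ^^ n) y - p) < e \<and> \<bar>u ((g ^^ n) y)\<bar> \<le> q ^ n * \<bar>u y\<bar>"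
    if y: "y \<in> pos_vecs" and e: "e \<le> \<eta>" and "norm (y - p) < e / K" for y e n
  proof -
    have start: "C * (\<bar>s y - s p\<bar> + \<bar>u y\<bar>) < e"
    proof -
      have "\<bar>s y - s p\<bar> + \<bar>u y\<bar> \<le> (1 + c) * norm (y - p) + (a + b) * norm (y - p)"
        using abs_s_le[of "y - p"] abs_u_le_dist[of y] by (simp add: s_diff)
      also have "\<dots> = (1 + a + b + c) * norm (y - p)" by (simp add: algebra_simps)
      finally have "C * (\<bar>s y - s p\<bar> + \<bar>u y\<bar>) \<le> K * norm (y - p)"
        using C by (simp add: K_def mult.assoc)
      also have "\<dots> < e" using that(3) K by (simp add: field_simps)
      finally show ?thesis .
    qed
    \<comment> \<open>The decay estimate at index \<open>n\<close> yields closeness at the same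
      \<open>n\<close>, which is what contraction requires to reach \<open>Suc n\<close>.\<close>
    have close: "norm ((g ^^ n) y - p) < e" if "\<bar>u ((g ^^ n) y)\<bar> \<le> q ^ n * \<bar>u y\<bar>" for n
    proof -
      have "q ^ n * \<bar>u y\<bar> \<le> 1 * \<bar>u y\<bar>"
        using q by (intro mult_right_mono power_le_one) auto
      with that have "C * (\<bar>s ((g ^^ n) y) - s p\<bar> + \<bar>u ((g ^^ n) y)\<bar>) \<le> C * (\<bar>s y - s p\<bar> + \<bar>u y\<bar>)"
        using C by (intro mult_left_mono) (auto simp: s_funpow_g[OF y])
      with start norm_diff_p_le[of "(g ^^ n) y"] show ?thesis by (simp add: C_def)
    qed
    have "\<bar>u ((g ^^ n) y)\<bar> \<le> q ^ n * \<bar>u y\<bar>"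
    proof (induction n)
      case (Suc n)
      have "\<bar>u (g ((g ^^ n) y))\<bar> \<le> q * \<bar>u ((g ^^ n) y)\<bar>"
        using close[OF Suc] e by (intro contr funpow_g_pos y) auto
      also have "\<dots> \<le> q * (q ^ n * \<bar>u y\<bar>)" by (intro mult_left_mono Suc q)
      finally show ?case by simp
    qed simp
    with close[OF this] show ?thesis by blast
  qed
  show "stable_fixed_point pos_vecs g p"
    unfolding stable_fixed_point_def
  proof (intro conjI allI impI)
    fix e :: real assume e: "0 < e"
    show "\<exists>\<delta>>0. \<forall>y\<in>pos_vecs. norm (y - p) < \<delta> \<longrightarrow> (\<forall>n. norm ((g ^^ n) y - p) < e)"
    proof (intro exI[of _ "min e \<eta> / K"] conjI ballI impI allI)
      show "norm ((g ^^ n) y - p) < e" if "y \<in> pos_vecs" "norm (y - p) < min e \<eta> / K" for y n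
        using key[OF that(1) _ that(2)] by simp
    qed (use e \<eta> K in simp)
  qed (rule g_p)
  show "\<exists>\<delta>>0. \<forall>y\<in>pos_vecs. s y = s p \<longrightarrow> norm (y - p) < \<delta> \<longrightarrow> (\<lambda>n. (g ^^ n) y) \<longlonglongrightarrow> p"
  proof (intro exI[of _ "\<eta> / K"] conjI ballI impI)
    fix y assume y: "y \<in> pos_vecs" "s y = s p" "norm (y - p) < \<eta> / K"
    \<comment> \<open>On the line \<open>s y = s p\<close> the invariant contributes nothing to the
      distance, so the decay of \<open>u\<close> alone forces convergence.\<close>
    have le: "norm ((g ^^ n) y - p) \<le> C * (q ^ n * \<bar>u y\<bar>)" for n
    proof -
      have "norm ((g ^^ n) y - p) \<le> C * \<bar>u ((g ^^ n) y)\<bar>"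
        using norm_diff_p_le[of "(g ^^ n) y"] by (simp add: C_def s_funpow_g y)
      also have "\<dots> \<le> C * (q ^ n * \<bar>u y\<bar>)"
        using key[OF y(1) order_refl y(3)] C by (intro mult_left_mono) auto
      finally show ?thesis .
    qed
    have "(\<lambda>n. C * (q ^ n * \<bar>u y\<bar>)) \<longlonglongrightarrow> 0"
      using q by (intro tendsto_mult_right_zero tendsto_mult_left_zero LIMSEQ_realpow_zero)
    then have "(\<lambda>n. (g ^^ n) y - p) \<longlonglongrightarrow> 0"
      by (rule Lim_null_comparison[OF always_eventually[OF allI[OF le]]])
    then show "(\<lambda>n. (g ^^ n) y) \<longlonglongrightarrow> p" by (simp add: LIM_zero_iff)
  qed (use \<eta> K in simp)
qed

text \<open>Stability would confine an orbit to the ball where \<open>u\<close> grows geometrically,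
  although \<open>u\<close> is bounded on that ball.\<close>

lemma unstable:
  assumes R: "1 < \<bar>1 - dt * (a * c + b)\<bar>"
  shows "unstable_fixed_point pos_vecs g p"
  unfolding unstable_fixed_point_def
proof (intro conjI notI)
  assume "stable_fixed_point pos_vecs g p"
  obtain q \<eta> where q: "1 < q" and \<eta>: "0 < \<eta>"
    and expand: "\<And>y. \<lbrakk>y \<in> pos_vecs; norm (y - p) < \<eta>\<rbrakk> \<Longrightarrow> q * \<bar>u y\<bar> \<le> \<bar>u (g y)\<bar>"
    using expansion[OF R] by metis
  obtain \<delta> where \<delta>: "0 < \<delta>"
    "\<And>y n. \<lbrakk>y \<in> pos_vecs; norm (y - p) < \<delta>\<rbrakk> \<Longrightarrow> norm ((g ^^ n) y - p) < \<eta>"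
    using \<open>stable_fixed_point pos_vecs g p\<close> \<eta> unfolding stable_fixed_point_def by metis
  \<comment> \<open>Raising the first coordinate keeps the point positive and gives
    \<open>u y = a * \<delta> / 2\<close>, a nonzero start for the growth.\<close>
  define y where "y = p + (\<delta> / 2) *\<^sub>R axis 1 1"
  have "y $ 1 = p $ 1 + \<delta> / 2" "y $ 2 = p $ 2" by (simp_all add: y_def axis_def)
  then have y: "y \<in> pos_vecs" and uy: "u y \<noteq> 0"
    using p_comp_pos[of 1] p_comp_pos[of 2] \<delta>(1) u_p pos
    by (auto simp: pos_vecs_def forall_2 u_def algebra_simps)
  have "norm (y - p) < \<delta>" using \<delta>(1) by (simp add: y_def)
  note near = \<delta>(2)[OF y this]
  have grow: "q ^ n * \<bar>u y\<bar> \<le> \<bar>u ((g ^^ n) y)\<bar>" for n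
  proof (induction n)
    case (Suc n)
    have "q ^ Suc n * \<bar>u y\<bar> = q * (q ^ n * \<bar>u y\<bar>)" by simp
    also have "\<dots> \<le> q * \<bar>u ((g ^^ n) y)\<bar>" using q by (intro mult_left_mono Suc) simp
    also have "\<dots> \<le> \<bar>u (g ((g ^^ n) y))\<bar>" by (intro expand funpow_g_pos y near)
    finally show ?case by simp
  qed simp
  have "q ^ n < (a + b) * \<eta> / \<bar>u y\<bar>" for n
  proof -
    have "q ^ n * \<bar>u y\<bar> \<le> (a + b) * norm ((g ^^ n) y - p)"
      using grow[of n] abs_u_le_dist[of "(g ^^ n) y"] by linarith
    also have "\<dots> < (a + b) * \<eta>" using pos near[of n] by simp
    finally show ?thesis using uy by (simp add: field_simps)
  qed
  moreover obtain n where "(a + b) * \<eta> / \<bar>u y\<bar> < q ^ n"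
    using real_arch_pow[OF q] by blast
  ultimately show False using less_asym by blast
qed (rule g_p)

end

section \<open>The stability statement for the scheme\<close>

theorem corollary11:
  fixes a b c dt :: real
    and A :: "real^2^2"
    and ystar :: "real^2"
    and \<sigma> :: "real^2 \<Rightarrow> real^2"
    and r :: "real^2 \<Rightarrow> real"
    and D :: "(real^2) set"
    and R :: "complex \<Rightarrow> complex"
  assumes "0 < a" "0 < b" "0 < c" "0 < dt"
    and "A = vector [vector [- a * c, b * c], vector [a, - b]]"
    and "ystar \<in> pos_vecs" "A *v ystar = 0"
    and "\<And>m. C2_on pos_vecs (\<lambda>v. \<sigma> v $ m)"
    and "C2_on pos_vecs r"
    and "\<And>m v. v \<in> pos_vecs \<Longrightarrow> 0 < \<sigma> v $ m"
    and "\<And>v. v \<in> pos_vecs \<Longrightarrow> 0 < r v"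
    and "open D" "ystar \<in> D" "D \<subseteq> pos_vecs"
    and "\<And>v. v \<in> D \<Longrightarrow> A *v v = 0 \<Longrightarrow> \<sigma> v = v"
    and "linear_stability_function explicit_euler R"
  shows "(\<forall>z. R z = 1 + z) \<and>
    jacobian_stability_function (gBBKS1 A \<sigma> r dt) ystar dt (- (a * c + b)) R \<and>
    (norm (R (of_real (- (a * c + b) * dt))) < 1 \<longrightarrow>
       stable_fixed_point pos_vecs (gBBKS1 A \<sigma> r dt) ystar \<and>
       (\<exists>\<delta>>0. \<forall>y\<in>pos_vecs.
          vector [1, c] \<bullet> y = vector [1, c] \<bullet> ystar \<longrightarrow> norm (y - ystar) < \<delta> \<longrightarrow>
          (\<lambda>n. (gBBKS1 A \<sigma> r dt ^^ n) y) \<longlonglongrightarrow> ystar)) \<and>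
    (1 < norm (R (of_real (- (a * c + b) * dt))) \<longrightarrow>
       unstable_fixed_point pos_vecs (gBBKS1 A \<sigma> r dt) ystar)"
proof -
  interpret gbbks_2d a b c dt A \<sigma> r
    using assms(1-5,10,11) by unfold_locales
  interpret gbbks_2d_steady a b c dt A \<sigma> r ystar
    using assms(6,7,8,9,13) assms(15)[of ystar]
    by unfold_locales (auto simp: A_mult_eq_0_iff intro: C2_on_imp_isCont)
  have R: "R z = 1 + z" for z
    using assms(16) by (rule linear_stability_function_explicit_euler)
  \<comment> \<open>At a real argument \<open>R\<close> is real, so the complex modulus becomes the
    absolute value of the factor of \<open>u\<close>.\<close>
  have norm_R: "norm (R (of_real (- (a * c + b) * dt))) = \<bar>1 - dt * (a * c + b)\<bar>"
  proof -
    have "R (of_real (- (a * c + b) * dt)) = of_real (1 - dt * (a * c + b))"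
      by (simp add: R algebra_simps)
    then show ?thesis by (simp only: norm_of_real real_norm_def)
  qed
  have s_inner: "vector [1, c] \<bullet> y = s y" for y :: "real^2"
    by (simp add: s_def inner_vec_def sum_2)
  have "jacobian_stability_function g ystar dt (- (a * c + b)) R"
    using has_derivative_g eigenvalues_jacobian
    by (auto simp: jacobian_stability_function_def differentiable_def R algebra_simps)
  then show ?thesis
    unfolding norm_R s_inner using R stable attracting unstable by blast
qed

end
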